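(* Let $V$ be a vector space of dimension $n\ge 2$ over a field, let $U$ and $W$ be an $m$-subspace and a $k$-subspace of $V$, respectively, and let $j:=\dim(U\cap W)$. Let $G$ be $\mathrm{GL}(V)$ or $\mathrm{SL}(V)$. Then $G=G_UG_WG_U$ if and only if $$\max\{0,m+k-n\}\le j\le \frac{k}{2}+\max\Big\{0,m-\frac{n}{2}\Big\}.$$
   Context: An $r$-subspace is a vector subspace of dimension $r$. For a subspace $X$ of $V$, $G_X$ denotes the (setwise) stabiliser of $X$ in $G$. For subgroups $P,Q$ of $G$, $PQP=\{pqp' : p,p'\in P,\ q\in Q\}$. *)

theory Defs
  imports
    Complex_Main
    "HOL-Algebra.Group_Action"
    "Jordan_Normal_Form.Determinant"
begin

definition ordered_basis :: "('a::field \<Rightarrow> 'b::ab_group_add \<Rightarrow> 'b) \<Rightarrow> 'b list \<Rightarrow> bool" where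
  "ordered_basis scale bs \<longleftrightarrow> distinct bs \<and> \<not> module.dependent scale (set bs) \<and>
     module.span scale (set bs) = UNIV"

definition endo_mat ::
    "('a::field \<Rightarrow> 'b::ab_group_add \<Rightarrow> 'b) \<Rightarrow> 'b list \<Rightarrow> ('b \<Rightarrow> 'b) \<Rightarrow> 'a mat" where
  "endo_mat scale bs f = mat (length bs) (length bs)
     (\<lambda>(i, j). module.representation scale (set bs) (f (bs ! j)) (bs ! i))"

text \<open>The choice of the ordered basis is irrelevant, see \<open>endo_det_eq\<close> below.\<close>

definition endo_det :: "('a::field \<Rightarrow> 'b::ab_group_add \<Rightarrow> 'b) \<Rightarrow> ('b \<Rightarrow> 'b) \<Rightarrow> 'a" where
  "endo_det scale f = det (endo_mat scale (SOME bs. ordered_basis scale bs) f)"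

definition GL :: "('a::field \<Rightarrow> 'b::ab_group_add \<Rightarrow> 'b) \<Rightarrow> ('b \<Rightarrow> 'b) monoid" where
  "GL scale =
     \<lparr>carrier = {f. Vector_Spaces.linear scale scale f \<and> bij f}, monoid.mult = (\<circ>), one = id\<rparr>"

definition SL :: "('a::field \<Rightarrow> 'b::ab_group_add \<Rightarrow> 'b) \<Rightarrow> ('b \<Rightarrow> 'b) monoid" where
  "SL scale = (GL scale)\<lparr>carrier := {f \<in> carrier (GL scale). endo_det scale f = 1}\<rparr>"

text \<open>For a group of maps, \<open>image\<close> is its action on sets, so this is the setwise stabiliser.\<close>

abbreviation setwise_stabilizer :: "('b \<Rightarrow> 'b) monoid \<Rightarrow> 'b set \<Rightarrow> ('b \<Rightarrow> 'b) set" where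
  "setwise_stabilizer G X \<equiv> stabilizer G (`) X"

text \<open>Matrix with respect to a basis \<open>bs\<close> in the source and a basis \<open>cs\<close> in the target.\<close>

definition map_mat2 :: "('a::field \<Rightarrow> 'b::ab_group_add \<Rightarrow> 'b) \<Rightarrow> 'b list \<Rightarrow> 'b list \<Rightarrow>
    ('b \<Rightarrow> 'b) \<Rightarrow> 'a mat" where
  "map_mat2 scale bs cs f = mat (length cs) (length bs)
     (\<lambda>(i, j). module.representation scale (set cs) (f (bs ! j)) (cs ! i))"

context
  fixes scale :: "'a::field \<Rightarrow> 'b::ab_group_add \<Rightarrow> 'b"  (infixr \<open>\<odot>\<close> 75)
  assumes vector_space: "vector_space scale"
begin

interpretation vector_space scale by (rule vector_space)

text \<open>
  In infinite dimension \<open>dim UNIV\<close> is \<open>0\<close>, so a positive value of \<open>dim UNIV\<close> entails that the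
  space is finite-dimensional.
\<close>

lemma finite_dimensional_if_dim_pos:
  assumes "dim UNIV > 0"
  shows "\<exists>B. finite_dimensional_vector_space scale B"
proof -
  obtain B where B: "independent B" "span B = UNIV" "card B = dim UNIV"
    using basis_exists[of UNIV] by (metis top.extremum_uniqueI)
  then have "finite B" using assms by (metis card.infinite less_numeral_extra(3))
  with B show ?thesis
    by (intro exI[of _ B]) (unfold_locales, auto)
qed

lemma ordered_basis_exists:
  assumes "finite_dimensional_vector_space scale B"
  shows "\<exists>bs. ordered_basis scale bs"
proof -
  interpret fd: finite_dimensional_vector_space scale B by fact
  from fd.finite_Basis obtain bs where "set bs = B" "distinct bs"
    using finite_distinct_list by blast
  then show ?thesis
    using fd.independent_Basis fd.span_Basis by (auto simp: ordered_basis_def)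
qed

lemma ordered_basis_length_eq:
  assumes "ordered_basis scale bs" "ordered_basis scale cs"
  shows "length bs = length cs"
proof -
  have "card (set bs) = dim UNIV" "card (set cs) = dim UNIV"
    using assms dim_eq_card[of "set bs" UNIV] dim_eq_card[of "set cs" UNIV]
    by (auto simp: ordered_basis_def)
  then show ?thesis using assms by (simp add: ordered_basis_def distinct_card)
qed

lemma endo_mat_eq_map_mat2: "endo_mat scale bs f = map_mat2 scale bs bs f"
  by (simp add: endo_mat_def map_mat2_def)

lemma sum_representation_nth:
  assumes "ordered_basis scale bs"
  shows "(\<Sum>i<length bs. representation (set bs) v (bs ! i) \<odot> (bs ! i)) = v"
proof -
  have "(\<Sum>b\<in>set bs. representation (set bs) v b \<odot> b) = v"
    using assms by (intro sum_representation_eq) (auto simp: ordered_basis_def)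
  moreover have "(\<Sum>b\<in>set bs. representation (set bs) v b \<odot> b) =
      (\<Sum>i<length bs. representation (set bs) v (bs ! i) \<odot> (bs ! i))"
    using assms
    by (intro sum.reindex_bij_betw[symmetric] bij_betw_nth) (auto simp: ordered_basis_def)
  ultimately show ?thesis by simp
qed

lemma map_mat2_comp:
  assumes "ordered_basis scale bs" "ordered_basis scale cs" "ordered_basis scale ds"
    and g: "Vector_Spaces.linear scale scale g"
  shows "map_mat2 scale bs ds (g \<circ> f) = map_mat2 scale cs ds g * map_mat2 scale bs cs f"
proof (rule eq_matI)
  fix i j assume "i < dim_row (map_mat2 scale cs ds g * map_mat2 scale bs cs f)"
    "j < dim_col (map_mat2 scale cs ds g * map_mat2 scale bs cs f)"
  then have ij: "i < length ds" "j < length bs" by (auto simp: map_mat2_def)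
  interpret g: Vector_Spaces.linear scale scale g by fact
  let ?r = "representation (set cs) (f (bs ! j))"
  have ds: "independent (set ds)" "span (set ds) = UNIV"
    using assms(3) by (auto simp: ordered_basis_def)
  have "g (f (bs ! j)) = g (\<Sum>l<length cs. ?r (cs ! l) \<odot> (cs ! l))"
    using sum_representation_nth[OF assms(2)] by simp
  also have "\<dots> = (\<Sum>l<length cs. ?r (cs ! l) \<odot> g (cs ! l))"
    by (simp add: g.sum g.scale)
  finally have "representation (set ds) (g (f (bs ! j))) (ds ! i) =
      (\<Sum>l<length cs. ?r (cs ! l) * representation (set ds) (g (cs ! l)) (ds ! i))"
    using ds by (simp add: representation_sum representation_scale)
  then show "map_mat2 scale bs ds (g \<circ> f) $$ (i, j) = (map_mat2 scale cs ds g * map_mat2 scale bs cs f) $$ (i, j)"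
    using ij by (simp add: map_mat2_def scalar_prod_def atLeast0LessThan mult.commute)
qed (auto simp: map_mat2_def)

lemma map_mat2_id:
  assumes "ordered_basis scale bs"
  shows "map_mat2 scale bs bs id = 1\<^sub>m (length bs)"
  using assms
  by (intro eq_matI)
     (auto simp: map_mat2_def ordered_basis_def representation_basis nth_eq_iff_index_eq)

lemma linear_id': "Vector_Spaces.linear scale scale id"
  by unfold_locales auto

lemma endo_det_eq:
  assumes bs: "ordered_basis scale bs" and f: "Vector_Spaces.linear scale scale f"
  shows "endo_det scale f = det (endo_mat scale bs f)"
proof -
  define cs where "cs = (SOME bs. ordered_basis scale bs)"
  have cs: "ordered_basis scale cs" unfolding cs_def using bs by (rule someI)
  have len: "length cs = length bs" using cs bs by (rule ordered_basis_length_eq)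
  define P where "P = map_mat2 scale bs cs id"
  define Q where "Q = map_mat2 scale cs bs id"
  have PQ: "P * Q = 1\<^sub>m (length bs)" "Q * P = 1\<^sub>m (length bs)"
    using map_mat2_comp[OF cs bs cs linear_id', of id] map_mat2_comp[OF bs cs bs linear_id', of id]
    by (simp_all add: P_def Q_def map_mat2_id bs cs len)
  have "map_mat2 scale cs cs f = P * (map_mat2 scale bs bs f * Q)"
    using map_mat2_comp[OF cs bs cs linear_id', of f] map_mat2_comp[OF cs bs bs f, of id]
    by (simp add: P_def Q_def)
  moreover have carr: "P \<in> carrier_mat (length bs) (length bs)"
      "Q \<in> carrier_mat (length bs) (length bs)"
      "map_mat2 scale bs bs f \<in> carrier_mat (length bs) (length bs)"
      "map_mat2 scale cs cs f \<in> carrier_mat (length bs) (length bs)"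
    by (auto simp: P_def Q_def map_mat2_def len)
  ultimately have "similar_mat (map_mat2 scale cs cs f) (map_mat2 scale bs bs f)"
    using PQ unfolding similar_mat_def similar_mat_wit_def Let_def
    by (intro exI[of _ P] exI[of _ Q]) auto
  then show ?thesis
    using det_similar by (simp add: endo_det_def endo_mat_eq_map_mat2 cs_def[symmetric])
qed

lemma endo_det_comp:
  assumes "ordered_basis scale bs" "Vector_Spaces.linear scale scale f"
    "Vector_Spaces.linear scale scale g"
  shows "endo_det scale (g \<circ> f) = endo_det scale g * endo_det scale f"
proof -
  have "Vector_Spaces.linear scale scale (g \<circ> f)"
    using assms(2,3) by (rule Vector_Spaces.linear_compose)
  moreover have "map_mat2 scale bs bs h \<in> carrier_mat (length bs) (length bs)" for h
    by (simp add: map_mat2_def)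
  ultimately show ?thesis
    using assms map_mat2_comp[of bs bs bs g f]
    by (simp add: endo_det_eq[of bs] endo_mat_eq_map_mat2 det_mult[of _ "length bs"])
qed

lemma endo_det_id: "ordered_basis scale bs \<Longrightarrow> endo_det scale id = 1"
  by (simp add: endo_det_eq linear_id' endo_mat_eq_map_mat2 map_mat2_id)

lemma linear_inv_bij:
  assumes "Vector_Spaces.linear scale scale f" "bij f"
  shows "Vector_Spaces.linear scale scale (inv_into UNIV f)"
proof -
  interpret f: Vector_Spaces.linear scale scale f by fact
  have inv: "f (inv_into UNIV f y) = y" "inv_into UNIV f (f y) = y" for y
    using \<open>bij f\<close> by (simp_all add: bij_is_surj surj_f_inv_f bij_is_inj)
  show ?thesis
  proof unfold_locales
    show "inv_into UNIV f (x + y) = inv_into UNIV f x + inv_into UNIV f y" for x y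
      by (metis inv f.add)
    show "inv_into UNIV f (r \<odot> x) = r \<odot> inv_into UNIV f x" for r x
      by (metis inv f.scale)
  qed
qed

lemma group_GL: "group (GL scale)"
proof (rule groupI)
  fix x y assume "x \<in> carrier (GL scale)" "y \<in> carrier (GL scale)"
  then show "x \<otimes>\<^bsub>GL scale\<^esub> y \<in> carrier (GL scale)"
    by (auto simp: GL_def intro: bij_comp Vector_Spaces.linear_compose)
next
  fix x assume x: "x \<in> carrier (GL scale)"
  then have "inv_into UNIV x \<in> carrier (GL scale)"
    by (auto simp: GL_def linear_inv_bij bij_imp_bij_inv)
  moreover have "inv_into UNIV x \<otimes>\<^bsub>GL scale\<^esub> x = \<one>\<^bsub>GL scale\<^esub>"
    using x by (auto simp: GL_def bij_is_inj)
  ultimately show "\<exists>y\<in>carrier (GL scale). y \<otimes>\<^bsub>GL scale\<^esub> x = \<one>\<^bsub>GL scale\<^esub>" by blast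
qed (auto simp: GL_def linear_id' comp_assoc)

lemma subgroup_SL:
  assumes "ordered_basis scale bs"
  shows "subgroup (carrier (SL scale)) (GL scale)"
proof -
  interpret group "GL scale" by (rule group_GL)
  have mult: "endo_det scale (g \<otimes>\<^bsub>GL scale\<^esub> f) = endo_det scale g * endo_det scale f"
    if "f \<in> carrier (GL scale)" "g \<in> carrier (GL scale)" for f g
    using that endo_det_comp[OF assms, of f g] by (simp add: GL_def)
  have one: "endo_det scale \<one>\<^bsub>GL scale\<^esub> = 1"
    using endo_det_id[OF assms] by (simp add: GL_def)
  show ?thesis
  proof (rule subgroupI)
    show "carrier (SL scale) \<noteq> {}" using one one_closed by (auto simp: SL_def)
  next
    fix f assume f: "f \<in> carrier (SL scale)"
    then have "endo_det scale (inv\<^bsub>GL scale\<^esub> f) = 1"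
      using mult[of f "inv\<^bsub>GL scale\<^esub> f"] one by (simp add: SL_def)
    then show "inv\<^bsub>GL scale\<^esub> f \<in> carrier (SL scale)" using f by (simp add: SL_def)
  qed (auto simp: SL_def mult)
qed

lemma group_SL:
  assumes "ordered_basis scale bs"
  shows "group (SL scale)"
  using group.subgroup_imp_group[OF group_GL subgroup_SL[OF assms]] by (simp add: SL_def)

end

end

theory Submission
  imports Defs
begin

text \<open>A double coset \<open>G\<^sub>U g G\<^sub>U\<close> is determined by \<open>dim (U \<inter> g U)\<close>, because \<open>SL(V)\<close> is
  transitive on pairs of subspaces with prescribed dimensions and dimension of intersection. Hence the
  factorisation says that every value of \<open>dim (U \<inter> g U)\<close> is attained by some \<open>g\<close> stabilising \<open>W\<close>.
  For such \<open>g\<close> both \<open>U \<inter> W\<close> and its image lie in \<open>W\<close>, and they meet in dimension at least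
  \<open>2 j - k\<close>; comparing with the smallest value \<open>max 0 (2 m - n)\<close> gives necessity. Conversely,
  products of transvections in a basis adapted to \<open>U\<close> and \<open>W\<close> attain every value.\<close>

context finite_dimensional_vector_space
begin

section \<open>Bases adapted to a pair of subspaces\<close>

lemma ordered_basis_length: "ordered_basis scale xs \<Longrightarrow> length xs = dim UNIV"
  using dim_eq_card[of "set xs" UNIV] by (auto simp: ordered_basis_def distinct_card)

lemma ordered_basis_dim_span:
  assumes "ordered_basis scale bs" and "S \<subseteq> set bs"
  shows "dim (span S) = card S"
  using assms independent_mono[of "set bs" S] dim_eq_card_independent
  by (auto simp: ordered_basis_def)

lemma ordered_basis_reorder:
  "ordered_basis scale xs \<Longrightarrow> mset xs = mset ys \<Longrightarrow> ordered_basis scale ys"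
  unfolding ordered_basis_def by (metis mset_eq_imp_distinct_iff mset_eq_setD)

text \<open>Since \<open>dim\<close> of a set is the dimension of its span,
  \<open>dim (S \<union> T)\<close> is the dimension of S + T, and this is Grassmann's formula
  without subtraction.\<close>

lemma dim_Un_plus_dim_Int:
  assumes "subspace S" "subspace T"
  shows "dim (S \<union> T) + dim (S \<inter> T) = dim S + dim T"
proof -
  have "dim (S \<union> T) = dim (span (S \<union> T))" by simp
  also have "span (S \<union> T) = {x + y |x y. x \<in> S \<and> y \<in> T}"
    using assms by (simp only: span_Un span_eq_iff[THEN iffD2])
  finally show ?thesis using dim_sums_Int[OF assms] by simp
qed

lemma basis_extend_list:
  assumes "distinct xs" "independent (set xs)" "set xs \<subseteq> S" "subspace S"
  obtains ys where "distinct (xs @ ys)" "independent (set (xs @ ys))" "span (set (xs @ ys)) = S"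
    "length (xs @ ys) = dim S"
proof -
  obtain B where B: "set xs \<subseteq> B" "B \<subseteq> S" "independent B" "S \<subseteq> span B"
    using assms(2,3) maximal_independent_subset_extend by metis
  then have "finite (B - set xs)" by (simp add: finiteI_independent)
  then obtain ys where ys: "set ys = B - set xs" "distinct ys"
    using finite_distinct_list by blast
  have "span B = S"
    using B assms(4) span_subspace by blast
  show ?thesis
  proof (intro that[of ys])
    have eq: "set (xs @ ys) = B" using B(1) ys by auto
    show d: "distinct (xs @ ys)" using assms(1) ys by auto
    show "independent (set (xs @ ys))" "span (set (xs @ ys)) = S"
      unfolding eq by fact+
    show "length (xs @ ys) = dim S"
      using distinct_card[OF d] dim_eq_card[of B S] B(3) \<open>span B = S\<close> assms(4)
      unfolding eq by (metis span_eq_iff)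
  qed
qed

text \<open>A basis \<open>as\<close> of the intersection is extended by \<open>bs\<close> to S and
  by \<open>cs\<close> to T; counting shows that the three blocks together are independent, and
  \<open>ds\<close> completes them. Lists rather than sets let later maps pair vectors by
  position.\<close>

lemma adapted_basis:
  assumes "subspace S" "subspace T"
  obtains as bs cs ds where "ordered_basis scale (as @ bs @ cs @ ds)"
    "span (set as) = S \<inter> T" "span (set (as @ bs)) = S" "span (set (as @ cs)) = T"
proof -
  have ST: "subspace (S \<inter> T)" using assms by (rule subspace_inter)
  obtain as where as: "distinct as" "independent (set as)" "span (set as) = S \<inter> T"
      "length as = dim (S \<inter> T)"
    using basis_extend_list[of "[]", OF _ _ _ ST] subspace_0[OF ST] by (auto simp: independent_empty)
  then have sub: "set as \<subseteq> S" "set as \<subseteq> T" using span_superset by blast+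
  obtain bs where bs: "span (set (as @ bs)) = S" "length (as @ bs) = dim S"
    using basis_extend_list[OF as(1,2) sub(1) assms(1)] by metis
  obtain cs where cs: "span (set (as @ cs)) = T" "length (as @ cs) = dim T"
    using basis_extend_list[OF as(1,2) sub(2) assms(2)] by metis
  let ?B = "as @ bs @ cs"
  have "span (S \<union> T) = span (set ?B)"
  proof (rule antisym)
    have "S \<subseteq> span (set ?B)" "T \<subseteq> span (set ?B)"
      unfolding bs(1)[symmetric] cs(1)[symmetric] by (intro span_mono; auto)+
    then show "span (S \<union> T) \<subseteq> span (set ?B)" by (simp add: span_minimal)
    have "set ?B \<subseteq> S \<union> T"
      using span_superset[of "set (as @ bs)"] span_superset[of "set (as @ cs)"] unfolding bs(1) cs(1) by auto
    then show "span (set ?B) \<subseteq> span (S \<union> T)" by (rule span_mono)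
  qed
  then have "dim (set ?B) = dim (S \<union> T)" by (metis dim_span)
  moreover have "length ?B = dim (S \<union> T)"
    using dim_Un_plus_dim_Int[OF assms] as(4) bs(2) cs(2) by simp
  ultimately have len: "length ?B = dim (set ?B)" by simp
  \<comment> \<open>A spanning list as long as the dimension can have neither linear dependencies
    nor repetitions.\<close>
  then have "card (set ?B) \<le> dim (set ?B)" using card_length[of ?B] by linarith
  then have ind: "independent (set ?B)"
    by (intro card_le_dim_spanning[of _ "set ?B"]) (auto intro: span_base)
  then have "distinct ?B" using len by (metis card_distinct dim_eq_card_independent)
  then obtain ds where "distinct (?B @ ds)" "independent (set (?B @ ds))" "span (set (?B @ ds)) = UNIV"
    using basis_extend_list[OF _ ind _ subspace_UNIV] by blast
  then have "ordered_basis scale (as @ bs @ cs @ ds)"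
    unfolding ordered_basis_def by simp
  with as(3) bs(1) cs(1) that show ?thesis by blast
qed

section \<open>Invertible maps prescribed on a basis, and correction of the determinant\<close>

lemma linear_on_basis:
  assumes "ordered_basis scale bs"
  shows "\<exists>f. Vector_Spaces.linear scale scale f \<and> (\<forall>b\<in>set bs. f b = g b)"
proof -
  interpret vector_space_pair scale scale by unfold_locales
  show ?thesis
    using linear_independent_extend[of "set bs" g] assms by (simp add: ordered_basis_def)
qed

lemma surj_in_GL:
  assumes "Vector_Spaces.linear scale scale f" "surj f"
  shows "f \<in> carrier (GL scale)"
  using assms linear_surj_imp_inj by (auto simp: GL_def bij_def)

lemma image_span_eqI:
  assumes "Vector_Spaces.linear scale scale f" "f ` S \<subseteq> span T" "T \<subseteq> span (f ` S)"
  shows "f ` span S = span T"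
proof -
  interpret f: Vector_Spaces.linear scale scale f by fact
  show ?thesis
    using assms(2,3) unfolding f.span_image[symmetric] by (intro antisym span_minimal) auto
qed

lemma basis_change:
  assumes "ordered_basis scale bs" "ordered_basis scale cs"
  obtains f where "f \<in> carrier (GL scale)" "map f bs = cs"
proof -
  have len: "length bs = length cs" using assms by (simp add: ordered_basis_length)
  have bs: "distinct bs" and cs: "span (set cs) = UNIV" and bsp: "span (set bs) = UNIV"
    using assms by (auto simp: ordered_basis_def)
  obtain f where lin: "Vector_Spaces.linear scale scale f"
    and f: "\<And>b. b \<in> set bs \<Longrightarrow> f b = the (map_of (zip bs cs) b)"
    using linear_on_basis[OF assms(1), of "\<lambda>b. the (map_of (zip bs cs) b)"] by blast
  have "map f bs = cs"
    using f len bs by (intro nth_equalityI) (auto simp: map_of_zip_nth)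
  moreover from this have "f ` span (set bs) = span (set cs)"
    using lin by (intro image_span_eqI) (auto intro: span_base)
  ultimately show ?thesis
    using that surj_in_GL[OF lin] cs bsp by simp
qed

text \<open>The map multiplies \<open>b\<close> by \<open>c\<close> and fixes the other basis
  vectors. It attains any nonzero determinant while preserving all coordinate subspaces.\<close>

lemma diagonal_det:
  assumes "ordered_basis scale (b # bs)" "c \<noteq> 0"
  obtains s where "s \<in> carrier (GL scale)" "endo_det scale s = c"
    "\<And>S. S \<subseteq> set (b # bs) \<Longrightarrow> s ` span S = span S"
proof -
  let ?B = "b # bs"
  have B: "independent (set ?B)" "span (set ?B) = UNIV" "distinct ?B"
    using assms(1) unfolding ordered_basis_def by blast+
  obtain s where lin: "Vector_Spaces.linear scale scale s"
    and s: "\<And>x. x \<in> set ?B \<Longrightarrow> s x = scale (if x = b then c else 1) x"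
    using linear_on_basis[OF assms(1), of "\<lambda>x. scale (if x = b then c else 1) x"] by blast
  have stab: "s ` span S = span S" if "S \<subseteq> set ?B" for S
  proof (rule image_span_eqI[OF lin])
    show "s ` S \<subseteq> span S"
    proof
      fix y assume "y \<in> s ` S"
      then obtain x where x: "x \<in> S" "y = s x" by blast
      then have "y = scale (if x = b then c else 1) x" using s that by blast
      then show "y \<in> span S" using x(1) by (metis span_base span_scale)
    qed
    show "S \<subseteq> span (s ` S)"
    proof
      fix x assume x: "x \<in> S"
      then have "scale (if x = b then inverse c else 1) (s x) = x"
        using s[of x] that assms(2) by auto
      moreover have "scale (if x = b then inverse c else 1) (s x) \<in> span (s ` S)"
        using x by (intro span_scale span_base) auto
      ultimately show "x \<in> span (s ` S)" by simp
    qed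
  qed
  have "s \<in> carrier (GL scale)"
    using stab[of "set ?B"] B(2) by (intro surj_in_GL[OF lin]) simp
  moreover have "endo_det scale s = c"
  proof -
    let ?M = "endo_mat scale ?B s"
    have ent: "?M $$ (i, j) = (if i = j then if i = 0 then c else 1 else 0)"
      if "i < length ?B" "j < length ?B" for i j
    proof -
      have "?B ! j \<in> set ?B" using that nth_mem by blast
      moreover from this have "representation (set ?B) (?B ! j) = (\<lambda>v. if v = ?B ! j then 1 else 0)"
        using B(1) by (intro representation_basis)
      moreover have "?B ! i = ?B ! j \<longleftrightarrow> i = j" using that B(3) nth_eq_iff_index_eq by blast
      moreover have "?B ! j = b \<longleftrightarrow> j = 0" using that B(3) nth_eq_iff_index_eq[of ?B j 0] by simp
      ultimately show ?thesis
        using that B(1,2) s[of "?B ! j"] representation_scale[of "set ?B" "?B ! j"]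
        by (simp add: endo_mat_def)
    qed
    have "endo_det scale s = det ?M"
      using endo_det_eq[OF vector_space_axioms assms(1) lin] .
    \<comment> \<open>The matrix is diag(c, 1, ..., 1), so in particular upper triangular.\<close>
    also have "det ?M = prod_list (diag_mat ?M)"
    proof (rule det_upper_triangular)
      have "dim_row ?M = length ?B" by (simp add: endo_mat_def)
      then show "upper_triangular ?M"
        unfolding upper_triangular_def by (metis ent less_trans not_less_iff_gr_or_eq)
      show "?M \<in> carrier_mat (length ?B) (length ?B)" by (simp add: endo_mat_def)
    qed
    also have "diag_mat ?M = map (\<lambda>i. if i = 0 then c else 1) [0..<length ?B]"
      using ent by (auto simp: diag_mat_def endo_mat_def)
    also have "\<dots> = c # map (\<lambda>i. 1) [1..<length ?B]"
      by (simp add: upt_conv_Cons del: upt_Suc)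
    also have "prod_list \<dots> = c" by (simp add: prod_list_replicate map_replicate_const)
    finally show ?thesis .
  qed
  ultimately show ?thesis using that stab by blast
qed

lemma endo_det_nonzero:
  assumes "f \<in> carrier (GL scale)"
  shows "endo_det scale f \<noteq> 0"
proof -
  obtain bs where bs: "ordered_basis scale bs"
    using ordered_basis_exists[OF vector_space_axioms] finite_dimensional_vector_space_axioms by blast
  have f: "Vector_Spaces.linear scale scale f" "bij f" using assms by (auto simp: GL_def)
  have "endo_det scale (f \<circ> inv_into UNIV f) = 1"
    using f endo_det_id[OF vector_space_axioms bs] by (simp add: surj_iff[THEN iffD1] bij_is_surj)
  then show ?thesis
    using endo_det_comp[OF vector_space_axioms bs linear_inv_bij[OF vector_space_axioms f] f(1)] by auto
qed

text \<open>Precompose \<open>f\<close> with a diagonal map of determinant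
  \<open>inverse (endo_det scale f)\<close>. That map preserves each span of basis vectors, so the
  images of these spans stay the same. This lets one argument serve GL(V) and SL(V).\<close>

lemma SL_adjust:
  assumes "ordered_basis scale bs" "dim UNIV > 0" "f \<in> carrier (GL scale)"
  obtains g where "g \<in> carrier (SL scale)" "\<And>S. S \<subseteq> set bs \<Longrightarrow> g ` span S = f ` span S"
proof -
  obtain b bs' where bs: "bs = b # bs'"
    using assms(1,2) ordered_basis_length[of bs] by (cases bs) fastforce+
  obtain s where s: "s \<in> carrier (GL scale)" "endo_det scale s = inverse (endo_det scale f)"
    "\<And>S. S \<subseteq> set bs \<Longrightarrow> s ` span S = span S"
    using diagonal_det[of b bs' "inverse (endo_det scale f)"] assms(1) endo_det_nonzero[OF assms(3)]
    unfolding bs by (metis inverse_nonzero_iff_nonzero)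
  have "f \<circ> s \<in> carrier (GL scale)"
    using assms(3) s(1) by (auto simp: GL_def bij_comp Vector_Spaces.linear_compose)
  moreover have "endo_det scale (f \<circ> s) = 1"
    using endo_det_comp[OF vector_space_axioms assms(1), of s f] assms(3) s(1,2) endo_det_nonzero[OF assms(3)]
    by (simp add: GL_def)
  ultimately have "f \<circ> s \<in> carrier (SL scale)" by (simp add: SL_def)
  then show ?thesis using that s(3) by (metis image_comp)
qed

section \<open>Transitivity of SL(V) on pairs of subspaces\<close>

text \<open>The three dimensions fix the block lengths of an adapted basis, so carrying one adapted
  basis to the other matches the blocks. The subspaces are spanned by blocks, hence correcting the
  determinant does not disturb their images.\<close>

lemma SL_transitive_on_pairs:
  assumes "subspace S" "subspace T" "subspace S'" "subspace T'"
    and "dim S = dim S'" "dim T = dim T'" "dim (S \<inter> T) = dim (S' \<inter> T')"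
    and "dim UNIV > 0"
  obtains p where "p \<in> carrier (SL scale)" "p ` S = S'" "p ` T = T'"
proof -
  obtain as bs cs ds where B: "ordered_basis scale (as @ bs @ cs @ ds)"
    "span (set as) = S \<inter> T" "span (set (as @ bs)) = S" "span (set (as @ cs)) = T"
    using adapted_basis[OF assms(1,2)] .
  obtain as' bs' cs' ds' where B': "ordered_basis scale (as' @ bs' @ cs' @ ds')"
    "span (set as') = S' \<inter> T'" "span (set (as' @ bs')) = S'" "span (set (as' @ cs')) = T'"
    using adapted_basis[OF assms(3,4)] .
  have len: "length as = dim (S \<inter> T)" "length (as @ bs) = dim S" "length (as @ cs) = dim T"
    if "ordered_basis scale (as @ bs @ cs @ ds)"
    "span (set as) = S \<inter> T" "span (set (as @ bs)) = S" "span (set (as @ cs)) = T"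
    for as bs cs ds S T
  proof -
    have "distinct as" "distinct (as @ bs)" "distinct (as @ cs)"
      using that(1) by (auto simp: ordered_basis_def)
    moreover have "dim (span (set as)) = card (set as)"
      "dim (span (set (as @ bs))) = card (set (as @ bs))"
      "dim (span (set (as @ cs))) = card (set (as @ cs))"
      by (intro ordered_basis_dim_span[OF that(1)]; auto)+
    ultimately show "length as = dim (S \<inter> T)" "length (as @ bs) = dim S" "length (as @ cs) = dim T"
      unfolding that(2-4) by (metis distinct_card)+
  qed
  have lens: "length as = length as'" "length bs = length bs'" "length cs = length cs'"
    using len[OF B] len[OF B'] assms(5-7) by simp_all
  obtain f where f: "f \<in> carrier (GL scale)" "map f (as @ bs @ cs @ ds) = as' @ bs' @ cs' @ ds'"
    using basis_change[OF B(1) B'(1)] .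
  then have maps: "map f as = as'" "map f bs = bs'" "map f cs = cs'"
    using lens by auto
  interpret f: Vector_Spaces.linear scale scale f using f(1) by (simp add: GL_def)
  have "f ` S = S'" "f ` T = T'"
    unfolding B(3,4)[symmetric] B'(3,4)[symmetric] f.span_image[symmetric]
    using maps by (auto simp: image_Un)
  moreover obtain p where "p \<in> carrier (SL scale)"
    "\<And>X. X \<subseteq> set (as @ bs @ cs @ ds) \<Longrightarrow> p ` span X = f ` span X"
    using SL_adjust[OF B(1) assms(8) f(1)] by blast
  moreover have "set (as @ bs) \<subseteq> set (as @ bs @ cs @ ds)" "set (as @ cs) \<subseteq> set (as @ bs @ cs @ ds)" by auto
  moreover note B(3,4)
  ultimately show ?thesis using that by metis
qed

section \<open>Products of transvections\<close>

text \<open>Let f send \<open>xs ! i\<close> to \<open>xs ! i + ys ! i\<close> for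
  \<open>i < t\<close> and fix the other basis vectors. With U the span of \<open>xs\<close>, U + f
  U gains exactly the first \<open>t\<close> vectors of \<open>ys\<close>, so the intersection loses
  dimension \<open>t\<close>. The condition on \<open>S\<close> makes its span invariant.\<close>

lemma transvection_product:
  assumes basis: "ordered_basis scale (xs @ ys)" and t: "t \<le> length xs" "t \<le> length ys"
    and S: "S \<subseteq> set (xs @ ys)" "\<And>i. i < t \<Longrightarrow> xs ! i \<in> S \<Longrightarrow> ys ! i \<in> S"
    and pos: "dim UNIV > 0"
  obtains q where "q \<in> carrier (SL scale)" "q ` span S = span S"
    "dim (span (set xs) \<inter> q ` span (set xs)) = length xs - t"
proof -
  have dist: "distinct xs" "distinct ys" "set xs \<inter> set ys = {}" and sp: "span (set (xs @ ys)) = UNIV"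
    using basis by (auto simp: ordered_basis_def)
  define h where "h b = (if b \<in> set (take t xs) then b + the (map_of (zip xs ys) b) else b)" for b
  obtain f where lin: "Vector_Spaces.linear scale scale f"
    and f: "\<And>b. b \<in> set (xs @ ys) \<Longrightarrow> f b = h b"
    using linear_on_basis[OF basis, of h] by blast
  interpret f: Vector_Spaces.linear scale scale f by fact
  have fx: "f (xs ! i) = xs ! i + ys ! i" if "i < t" for i
  proof -
    have "xs ! i \<in> set (take t xs)" using that t by (metis in_set_conv_nth length_take min.absorb2 nth_take)
    moreover have "map_of (zip xs ys) (xs ! i) = Some (ys ! i)"
    proof -
      have "(xs ! i, ys ! i) \<in> set (zip xs ys)" using that t by (auto simp: set_zip)
      moreover have "distinct (map fst (zip xs ys))" using dist by (simp add: map_fst_zip_take)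
      ultimately show ?thesis by (metis map_of_eq_Some_iff)
    qed
    ultimately show ?thesis using f[of "xs ! i"] that t by (simp add: h_def)
  qed
  have fid: "f b = b" if "b \<in> set (xs @ ys)" "\<And>i. i < t \<Longrightarrow> b \<noteq> xs ! i" for b
  proof -
    have "b \<notin> set (take t xs)" using that(2) by (auto simp: in_set_conv_nth)
    then show ?thesis using f[OF that(1)] by (simp add: h_def)
  qed
  have fy: "f (ys ! i) = ys ! i" if "i < t" for i
  proof -
    have y: "ys ! i \<in> set ys" using that t by simp
    have "ys ! i \<noteq> xs ! l" if "l < t" for l
    proof -
      have "xs ! l \<in> set xs" using that t by simp
      then show ?thesis using y dist(3) by (metis disjoint_iff)
    qed
    with y show ?thesis by (intro fid) auto
  qed
  \<comment> \<open>Proved for every admissible set: the whole basis will give surjectivity, the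
    given \<open>S\<close> the required invariance.\<close>
  have stab: "f ` span S = span S"
    if S: "S \<subseteq> set (xs @ ys)" "\<And>i. i < t \<Longrightarrow> xs ! i \<in> S \<Longrightarrow> ys ! i \<in> S" for S
  proof (rule image_span_eqI[OF lin])
    have "f b \<in> span S \<and> b \<in> span (f ` S)" if b: "b \<in> S" for b
    proof (cases "\<exists>i<t. b = xs ! i")
      case True
      then obtain i where i: "i < t" "b = xs ! i" by blast
      with b S have y: "ys ! i \<in> S" by blast
      \<comment> \<open>As f fixes \<open>ys ! i\<close>, this difference is
        \<open>xs ! i\<close>.\<close>
      have "f (xs ! i) - f (ys ! i) \<in> span (f ` S)"
        using b y i by (intro span_diff span_base) auto
      moreover have "xs ! i + ys ! i \<in> span S"
        using b y i by (intro span_add span_base) auto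
      ultimately show ?thesis using i by (simp add: fx fy)
    next
      case False
      then have "f b = b" using b S by (intro fid) auto
      moreover have "f b \<in> span (f ` S)" "b \<in> span S" using b by (auto intro: span_base)
      ultimately show ?thesis by simp
    qed
    then show "f ` S \<subseteq> span S" "S \<subseteq> span (f ` S)" by auto
  qed
  have "surj f"
    using stab[of "set (xs @ ys)"] t unfolding sp by (simp add: nth_mem)
  then have GL: "f \<in> carrier (GL scale)" by (rule surj_in_GL[OF lin])
  \<comment> \<open>Only images of coordinate subspaces matter, so \<open>SL_adjust\<close> replaces
    a computation of the determinant of f.\<close>
  obtain q where q: "q \<in> carrier (SL scale)"
    "\<And>X. X \<subseteq> set (xs @ ys) \<Longrightarrow> q ` span X = f ` span X"
    using SL_adjust[OF basis pos GL] by blast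
  let ?U = "span (set xs)"
  have "span (?U \<union> f ` ?U) = span (set xs \<union> set (take t ys))"
  proof (rule antisym; rule span_minimal)
    have "f b \<in> span (set xs \<union> set (take t ys))" if b: "b \<in> set xs" for b
    proof (cases "\<exists>i<t. b = xs ! i")
      case True
      then obtain i where i: "i < t" "b = xs ! i" by blast
      have "ys ! i \<in> set (take t ys)"
        using i t by (metis in_set_conv_nth length_take min.absorb2 nth_take)
      then have "xs ! i + ys ! i \<in> span (set xs \<union> set (take t ys))"
        using b i(2) by (intro span_add span_base) auto
      then show ?thesis using i by (simp add: fx)
    next
      case False
      then have "f b = b" using b by (intro fid) auto
      then show ?thesis using b by (auto intro: span_base)
    qed
    then have "f ` ?U \<subseteq> span (set xs \<union> set (take t ys))"
      unfolding f.span_image[symmetric] by (intro span_minimal) auto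
    then show "?U \<union> f ` ?U \<subseteq> span (set xs \<union> set (take t ys))"
      by (simp add: span_mono)
    have "ys ! i \<in> span (?U \<union> f ` ?U)" if "i < t" for i
    proof -
      have "xs ! i \<in> ?U" using that t by (auto intro: span_base)
      then have "f (xs ! i) - xs ! i \<in> span (?U \<union> f ` ?U)"
        by (intro span_diff span_base) auto
      then show ?thesis using that by (simp add: fx)
    qed
    then have "set (take t ys) \<subseteq> span (?U \<union> f ` ?U)" by (auto simp: in_set_conv_nth)
    moreover have "set xs \<subseteq> span (?U \<union> f ` ?U)"
      by (meson Un_upper1 order_trans span_superset)
    ultimately show "set xs \<union> set (take t ys) \<subseteq> span (?U \<union> f ` ?U)" by simp
  qed simp_all
  then have "dim (?U \<union> f ` ?U) = dim (span (set xs \<union> set (take t ys)))" by (metis dim_span)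
  also have "\<dots> = card (set xs \<union> set (take t ys))"
    using set_take_subset[of t ys] by (intro ordered_basis_dim_span[OF basis]) auto
  also have "\<dots> = length xs + t"
    using dist t set_take_subset[of t ys] by (subst card_Un_disjoint) (auto simp: distinct_card)
  finally have sum: "dim (?U \<union> f ` ?U) = length xs + t" .
  have dU: "dim ?U = length xs"
    using ordered_basis_dim_span[OF basis, of "set xs"] dist by (simp add: distinct_card)
  interpret pair: finite_dimensional_vector_space_pair scale Basis scale Basis by unfold_locales
  have "dim (f ` ?U) = dim ?U"
    using GL by (intro pair.dim_image_eq[OF lin]) (auto simp: GL_def bij_def intro: inj_on_subset)
  then have "dim (?U \<inter> f ` ?U) = length xs - t"
    using dim_Un_plus_dim_Int[of ?U "f ` ?U"] sum dU f.subspace_image by simp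
  then show ?thesis using q(2)[of "set xs"] q(2)[OF S(1)] stab[OF S] by (intro that[OF q(1)]) auto
qed

section \<open>Double cosets and the factorisation criterion\<close>

text \<open>Factors on either side that stabilise U leave dim (U \<inter> g U) unchanged;
  conversely, transitivity on pairs recovers such factors from equal dimensions. Assuming only that
  G lies between SL(V) and GL(V) covers both groups at once.\<close>

lemma double_coset_dims:
  fixes G :: "('b \<Rightarrow> 'b) monoid"
  assumes "group G" and mult: "\<And>x y. x \<otimes>\<^bsub>G\<^esub> y = x \<circ> y"
    and SL: "carrier (SL scale) \<subseteq> carrier G" and GL: "carrier G \<subseteq> carrier (GL scale)"
    and U: "subspace U" and pos: "dim UNIV > 0"
  shows "carrier G = setwise_stabilizer G U <#>\<^bsub>G\<^esub> setwise_stabilizer G W <#>\<^bsub>G\<^esub> setwise_stabilizer G U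
    \<longleftrightarrow> (\<forall>g\<in>carrier G. \<exists>q\<in>setwise_stabilizer G W. dim (U \<inter> q ` U) = dim (U \<inter> g ` U))"
    (is "?L \<longleftrightarrow> ?R")
proof -
  interpret group G by fact
  interpret pair: finite_dimensional_vector_space_pair scale Basis scale Basis by unfold_locales
  have lin: "Vector_Spaces.linear scale scale g" and bij: "bij g" if "g \<in> carrier G" for g
    using that GL by (auto simp: GL_def)
  have sub: "subspace (g ` S)" if "g \<in> carrier G" "subspace S" for g S
    using pair.linear_subspace_image[OF lin] that by blast
  have dim: "dim (g ` S) = dim S" if "g \<in> carrier G" for g S
    using that lin bij by (intro pair.dim_image_eq) (auto simp: bij_def intro: inj_on_subset)
  show ?thesis
  proof
    assume ?L
    show ?R
    proof
      fix g assume "g \<in> carrier G"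
      then obtain p q p' where pqp: "p \<in> setwise_stabilizer G U" "q \<in> setwise_stabilizer G W"
        "p' \<in> setwise_stabilizer G U" "g = p \<circ> q \<circ> p'"
        using \<open>?L\<close> by (auto simp: set_mult_def mult)
      then have p: "p \<in> carrier G" "p ` U = U" "p' ` U = U" by (auto simp: stabilizer_def)
      have "g ` U = p ` q ` p' ` U" unfolding pqp(4) by (simp only: image_comp o_assoc)
      then have "U \<inter> g ` U = p ` U \<inter> p ` q ` U"
        using p by simp
      also have "\<dots> = p ` (U \<inter> q ` U)"
        using bij[OF p(1)] by (simp add: image_Int bij_def)
      finally show "\<exists>q\<in>setwise_stabilizer G W. dim (U \<inter> q ` U) = dim (U \<inter> g ` U)"
        using pqp(2) dim[OF p(1)] by auto
    qed
  next
    assume ?R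
    show ?L
    proof (rule antisym)
      show "carrier G \<subseteq> setwise_stabilizer G U <#>\<^bsub>G\<^esub> setwise_stabilizer G W <#>\<^bsub>G\<^esub> setwise_stabilizer G U"
      proof
        fix g assume g: "g \<in> carrier G"
        then obtain q where q: "q \<in> setwise_stabilizer G W" "dim (U \<inter> q ` U) = dim (U \<inter> g ` U)"
          using \<open>?R\<close> by blast
        then have qG: "q \<in> carrier G" by (auto simp: stabilizer_def)
        \<comment> \<open>The pairs (U, q U) and (U, g U) have the same three dimensions.\<close>
        obtain p where "p \<in> carrier (SL scale)" and p: "p ` U = U" "p ` q ` U = g ` U"
          using SL_transitive_on_pairs[OF U sub[OF qG U] U sub[OF g U] _ _ q(2) pos]
            dim[OF qG] dim[OF g] by metis
        then have pG: "p \<in> carrier G" using SL by blast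
        \<comment> \<open>The right factor is forced by g = p q p'. It stabilises U because p q and
          g send U to the same subspace.\<close>
        define p' where "p' = inv\<^bsub>G\<^esub> (p \<otimes>\<^bsub>G\<^esub> q) \<otimes>\<^bsub>G\<^esub> g"
        have p'G: "p' \<in> carrier G" using pG qG g by (simp add: p'_def)
        have eq: "g = p \<otimes>\<^bsub>G\<^esub> q \<otimes>\<^bsub>G\<^esub> p'"
          using pG qG g by (simp add: p'_def m_assoc[symmetric])
        have "(p \<circ> q) ` p' ` U = (p \<circ> q) ` U"
          using eq p(2) by (simp add: mult image_comp)
        moreover have "inj (p \<circ> q)" using bij[OF pG] bij[OF qG] by (simp add: bij_is_inj inj_compose)
        ultimately have "p' ` U = U" by (metis inj_image_eq_iff)
        then show "g \<in> setwise_stabilizer G U <#>\<^bsub>G\<^esub> setwise_stabilizer G W <#>\<^bsub>G\<^esub> setwise_stabilizer G U"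
          using eq pG p'G p(1) q(1) unfolding set_mult_def stabilizer_def by blast
      qed
    qed (auto simp: set_mult_def stabilizer_def)
  qed
qed

text \<open>The second bound compares U + f U with V. Together they delimit the values that elements
  stabilising W must realise.\<close>

lemma dim_inter_image_bounds:
  assumes "f \<in> carrier (GL scale)" "subspace U"
  shows "dim (U \<inter> f ` U) \<le> dim U" "2 * dim U \<le> dim UNIV + dim (U \<inter> f ` U)"
proof -
  interpret pair: finite_dimensional_vector_space_pair scale Basis scale Basis by unfold_locales
  have lin: "Vector_Spaces.linear scale scale f" and "inj f"
    using assms(1) by (auto simp: GL_def bij_def)
  then have "dim (f ` U) = dim U" "subspace (f ` U)"
    using assms(2) pair.linear_subspace_image pair.dim_image_eq[OF lin, of U]
    by (auto intro: inj_on_subset)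
  then show "2 * dim U \<le> dim UNIV + dim (U \<inter> f ` U)"
    using dim_Un_plus_dim_Int[of U "f ` U"] assms(2) dim_subset[of "U \<union> f ` U" UNIV] by simp
  show "dim (U \<inter> f ` U) \<le> dim U" by (intro dim_subset) auto
qed

text \<open>Writing \<open>a, b, c, d\<close> for the sizes of the four parts of a basis adapted to \<open>W\<close> and \<open>U\<close>, the
  bound on \<open>j\<close> says \<open>a \<le> b\<close> or \<open>d \<le> c\<close>. In either case a maximal matching of the part in \<open>U\<close> with
  the part outside \<open>U\<close> can be chosen so that it sends the part in \<open>U \<inter> W\<close> into \<open>W\<close>.\<close>

lemma stabilizer_realises_dim:
  assumes U: "subspace U" and W: "subspace W" and pos: "dim UNIV > 0"
    and j: "2 * dim (U \<inter> W) \<le> dim W + (2 * dim U - dim UNIV)"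
    and t: "t \<le> dim U" "t \<le> dim UNIV - dim U"
  obtains q where "q \<in> carrier (SL scale)" "q ` W = W" "dim (U \<inter> q ` U) = dim U - t"
proof -
  obtain as bs cs ds where B: "ordered_basis scale (as @ bs @ cs @ ds)"
    "span (set as) = W \<inter> U" "span (set (as @ bs)) = W" "span (set (as @ cs)) = U"
    using adapted_basis[OF W U] .
  have dist: "distinct (as @ bs @ cs @ ds)" using B(1) by (simp add: ordered_basis_def)
  have len: "length as = dim (U \<inter> W)" "length as + length bs = dim W" "length as + length cs = dim U"
    "length as + length bs + length cs + length ds = dim UNIV"
  proof -
    have *: "dim (span (set xs)) = length xs"
      if "distinct xs" "set xs \<subseteq> set (as @ bs @ cs @ ds)" for xs
      using ordered_basis_dim_span[OF B(1) that(2)] distinct_card[OF that(1)] by simp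
    have "dim (span (set as)) = length as" "dim (span (set (as @ bs))) = length (as @ bs)"
      "dim (span (set (as @ cs))) = length (as @ cs)"
      by (rule *; use dist in auto)+
    then show "length as = dim (U \<inter> W)" "length as + length bs = dim W"
      "length as + length cs = dim U"
      unfolding B(2-4) by (simp_all add: Int_commute)
    show "length as + length bs + length cs + length ds = dim UNIV"
      using ordered_basis_length[OF B(1)] by simp
  qed
  let ?S = "set (as @ bs)"
  note result = that
  \<comment> \<open>It suffices to arrange the adapted basis as \<open>xs\<close> spanning U
    followed by the rest \<open>ys\<close>, such that for \<open>i < t\<close> an entry of
    \<open>xs\<close> in the basis \<open>?S\<close> of W has its partner in
    \<open>?S\<close>.\<close>
  have *: thesis
    if h: "mset (as @ bs @ cs @ ds) = mset (xs @ ys)" "set xs = set (as @ cs)"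
      "length xs = dim U" "length ys = dim UNIV - dim U"
      "\<And>i. i < t \<Longrightarrow> xs ! i \<in> ?S \<Longrightarrow> ys ! i \<in> ?S" for xs ys
  proof -
    have "?S \<subseteq> set (xs @ ys)" using mset_eq_setD[OF h(1)] by auto
    then obtain q where "q \<in> carrier (SL scale)" "q ` span ?S = span ?S"
      "dim (span (set xs) \<inter> q ` span (set xs)) = length xs - t"
      using transvection_product[OF ordered_basis_reorder[OF B(1) h(1)], of t ?S] t h(3-5) pos
      by metis
    then show thesis unfolding h(2,3) B(3,4) by (rule result)
  qed
  \<comment> \<open>In block sizes the bound is a \<le> b + max 0 (a + c - b - d): a zero maximum
    gives a \<le> b, a positive one gives d \<le> c.\<close>
  have "length as \<le> length bs \<or> length ds \<le> length cs"
    using j len by linarith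
  then show thesis
  proof
    assume le: "length as \<le> length bs"
    \<comment> \<open>Each vector of \<open>as\<close> has its partner in \<open>bs\<close>; those
      of \<open>cs\<close> are not in \<open>?S\<close> and may have any partner.\<close>
    show thesis
    proof (rule *[of "as @ cs" "bs @ ds"])
      fix i assume i: "i < t" "(as @ cs) ! i \<in> ?S"
      have "i < length as"
      proof (rule ccontr)
        assume "\<not> i < length as"
        then have "(as @ cs) ! i \<in> set cs" using i(1) t(1) len by (simp add: nth_append)
        then show False using i(2) dist by auto
      qed
      then show "(bs @ ds) ! i \<in> ?S" using le by (simp add: nth_append)
    qed (use len in auto)
  next
    assume le: "length ds \<le> length cs"
    \<comment> \<open>Now \<open>cs\<close> comes first and uses up all of \<open>ds\<close>. Any
      vector of \<open>as\<close> among the first \<open>t\<close> is then paired with one of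
      \<open>bs\<close>, which exists since t \<le> n - m.\<close>
    show thesis
    proof (rule *[of "cs @ as" "ds @ bs"])
      fix i assume i: "i < t" "(cs @ as) ! i \<in> ?S"
      have "length cs \<le> i"
      proof (rule ccontr)
        assume "\<not> length cs \<le> i"
        then have "(cs @ as) ! i \<in> set cs" by (simp add: nth_append)
        then show False using i(2) dist by auto
      qed
      then show "(ds @ bs) ! i \<in> ?S" using le i(1) t(2) len by (simp add: nth_append)
    qed (use len in auto)
  qed
qed

text \<open>Grassmann's formula for X = U \<inter> W and f X, both inside W, whose intersection lies
  in U \<inter> f U.\<close>

lemma dim_inter_le_if_stabilizes:
  assumes "f \<in> carrier (GL scale)" "subspace U" "subspace W" "f ` W = W"
  shows "2 * dim (U \<inter> W) \<le> dim W + dim (U \<inter> f ` U)"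
proof -
  interpret pair: finite_dimensional_vector_space_pair scale Basis scale Basis by unfold_locales
  have lin: "Vector_Spaces.linear scale scale f" and "inj f"
    using assms(1) by (auto simp: GL_def bij_def)
  let ?X = "U \<inter> W"
  have X: "subspace ?X" using assms(2,3) by (rule subspace_inter)
  have "dim (f ` ?X) = dim ?X" "subspace (f ` ?X)"
    using X \<open>inj f\<close> pair.linear_subspace_image[OF lin] pair.dim_image_eq[OF lin, of ?X]
    by (auto intro: inj_on_subset)
  moreover have "dim (?X \<union> f ` ?X) \<le> dim W" "dim (?X \<inter> f ` ?X) \<le> dim (U \<inter> f ` U)"
    using assms(4) by (auto intro!: dim_subset)
  ultimately show ?thesis using dim_Un_plus_dim_Int[OF X, of "f ` ?X"] by simp
qed

text \<open>Truncated subtraction makes \<open>2 * dim U - dim UNIV\<close> equal to max 0 (2 m -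
  n), so the right-hand side is twice the upper bound on j.\<close>

lemma triple_product_iff:
  fixes G :: "('b \<Rightarrow> 'b) monoid"
  assumes "group G" and "\<And>x y. x \<otimes>\<^bsub>G\<^esub> y = x \<circ> y"
    and SL: "carrier (SL scale) \<subseteq> carrier G" and GL: "carrier G \<subseteq> carrier (GL scale)"
    and U: "subspace U" and W: "subspace W" and pos: "dim UNIV > 0"
  shows "carrier G = setwise_stabilizer G U <#>\<^bsub>G\<^esub> setwise_stabilizer G W <#>\<^bsub>G\<^esub> setwise_stabilizer G U
    \<longleftrightarrow> 2 * dim (U \<inter> W) \<le> dim W + (2 * dim U - dim UNIV)"
  unfolding double_coset_dims[OF assms(1-5) pos]
proof
  assume R: "\<forall>g\<in>carrier G. \<exists>q\<in>setwise_stabilizer G W. dim (U \<inter> q ` U) = dim (U \<inter> g ` U)"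
  \<comment> \<open>For necessity, test a g with dim (U \<inter> g U) minimal. It comes from
    \<open>stabilizer_realises_dim\<close> with V in place of W, where the bound always
    holds.\<close>
  obtain g where "g \<in> carrier (SL scale)" and
    g: "dim (U \<inter> g ` U) = dim U - min (dim U) (dim UNIV - dim U)"
  proof (rule stabilizer_realises_dim[OF U subspace_UNIV pos,
      of "min (dim U) (dim UNIV - dim U)"])
    show "2 * dim (U \<inter> UNIV) \<le> dim UNIV + (2 * dim U - dim UNIV)"
      unfolding Int_UNIV_right by linarith
  qed (auto intro: min.cobounded1 min.cobounded2)
  then obtain q where q: "q \<in> setwise_stabilizer G W" "dim (U \<inter> q ` U) = dim (U \<inter> g ` U)"
    using R SL by blast
  then have "q \<in> carrier G" "q ` W = W" by (auto simp: stabilizer_def)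
  then have "2 * dim (U \<inter> W) \<le> dim W + dim (U \<inter> g ` U)"
    using dim_inter_le_if_stabilizes[OF _ U W, of q] GL q(2) by auto
  moreover have "dim U - min (dim U) (dim UNIV - dim U) = 2 * dim U - dim UNIV"
    using dim_subset[OF subset_UNIV, of U] by linarith
  ultimately show "2 * dim (U \<inter> W) \<le> dim W + (2 * dim U - dim UNIV)"
    using g by simp
next
  assume j: "2 * dim (U \<inter> W) \<le> dim W + (2 * dim U - dim UNIV)"
  show "\<forall>g\<in>carrier G. \<exists>q\<in>setwise_stabilizer G W. dim (U \<inter> q ` U) = dim (U \<inter> g ` U)"
  proof
    fix g assume "g \<in> carrier G"
    then have b: "dim (U \<inter> g ` U) \<le> dim U" "2 * dim U \<le> dim UNIV + dim (U \<inter> g ` U)"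
      using dim_inter_image_bounds U GL by blast+
    \<comment> \<open>The number of transvections is the dimension that U must lose on intersecting
      with its image.\<close>
    have t: "dim U - dim (U \<inter> g ` U) \<le> dim U"
      "dim U - dim (U \<inter> g ` U) \<le> dim UNIV - dim U"
      using b by linarith+
    obtain q where "q \<in> carrier (SL scale)" "q ` W = W"
      "dim (U \<inter> q ` U) = dim U - (dim U - dim (U \<inter> g ` U))"
      using stabilizer_realises_dim[OF U W pos j t] by blast
    then show "\<exists>q\<in>setwise_stabilizer G W. dim (U \<inter> q ` U) = dim (U \<inter> g ` U)"
      using SL b(1) by (intro bexI[of _ q]) (auto simp: stabilizer_def)
  qed
qed

end

theorem theorem1p1:
  fixes scale :: "'a::field \<Rightarrow> 'b::ab_group_add \<Rightarrow> 'b"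
    and U W :: "'b set" and n m k j :: nat and G :: "('b \<Rightarrow> 'b) monoid"
  assumes "vector_space scale"
    and "vector_space.dim scale UNIV = n" and "n \<ge> 2"
    and "module.subspace scale U" and "vector_space.dim scale U = m"
    and "module.subspace scale W" and "vector_space.dim scale W = k"
    and "j = vector_space.dim scale (U \<inter> W)"
    and "G = GL scale \<or> G = SL scale"
  shows "carrier G = setwise_stabilizer G U <#>\<^bsub>G\<^esub> setwise_stabilizer G W <#>\<^bsub>G\<^esub> setwise_stabilizer G U
    \<longleftrightarrow> max 0 (real m + real k - real n) \<le> real j
      \<and> real j \<le> real k / 2 + max 0 (real m - real n / 2)"
proof -
  interpret vector_space scale by fact
  have pos: "dim UNIV > 0" using assms(2,3) by simp
  then obtain B where "finite_dimensional_vector_space scale B"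
    using finite_dimensional_if_dim_pos[OF assms(1)] by blast
  then interpret finite_dimensional_vector_space scale B .
  obtain bs where bs: "ordered_basis scale bs"
    using ordered_basis_exists[OF assms(1)] finite_dimensional_vector_space_axioms by blast
  have "group G"
    using assms(9) group_GL[OF assms(1)] group_SL[OF assms(1) bs] by blast
  moreover have "x \<otimes>\<^bsub>G\<^esub> y = x \<circ> y" for x y
    using assms(9) by (auto simp: GL_def SL_def)
  moreover have "carrier (SL scale) \<subseteq> carrier G" "carrier G \<subseteq> carrier (GL scale)"
    using assms(9) by (auto simp: SL_def)
  ultimately have "carrier G = setwise_stabilizer G U <#>\<^bsub>G\<^esub> setwise_stabilizer G W <#>\<^bsub>G\<^esub> setwise_stabilizer G U
    \<longleftrightarrow> 2 * j \<le> k + (2 * m - n)"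
    using triple_product_iff[OF _ _ _ _ assms(4,6) pos, of G] unfolding assms(2,5,7) assms(8)[symmetric]
    by blast
  also have "\<dots> \<longleftrightarrow> max 0 (real m + real k - real n) \<le> real j
      \<and> real j \<le> real k / 2 + max 0 (real m - real n / 2)"
  proof -
    \<comment> \<open>The lower bound on j holds for every pair U, W, since U + W lies in V; the
      upper bound carries the equivalence.\<close>
    have "m + k \<le> n + j"
      using dim_Un_plus_dim_Int[OF assms(4,6)] dim_subset[of "U \<union> W" UNIV]
      unfolding assms(2,5,7) assms(8)[symmetric] by simp
    then have "max 0 (real m + real k - real n) \<le> real j" by linarith
    moreover have "2 * j \<le> k + (2 * m - n) \<longleftrightarrow> real j \<le> real k / 2 + max 0 (real m - real n / 2)"
      by (simp add: max_def) linarith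
    ultimately show ?thesis by blast
  qed
  finally show ?thesis .
qed

end
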